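(* Let $P,Q:\mathbb{R}^d\to\mathbb{R}^d$ and $R:=P+Q$. Assume that: (i) (Minty assumption) there exists $x^*\in\mathbb{R}^d$ such that $\langle R(x),x-x^*\rangle\ge 0$ for all $x\in\mathbb{R}^d$; (ii) $Q$ is $L_q$-Lipschitz and monotone; (iii) $P$ is $L_p$-Lipschitz. Consider the Extragradient Sliding algorithm started at $x^0\in\mathbb{R}^d$ with parameters $\theta=\frac{1}{2L_p}$, $\eta=\frac{\theta}{2}$, and assume that at every iteration $k$ the approximate solution $u^k$ of the inner subproblem satisfies $$\|B_\theta^k(u^k)\|^2\le \frac{L_p^2}{3}\,\|x^k-\tilde u^k\|^2 .$$ Then, to achieve an $\varepsilon$-solution, with accuracy measured by $\|R(u)\|$ (that is, an iterate $u=u^j$ with $\|R(u)\|\le\varepsilon$), the algorithm needs $$\mathcal{O}\left(\frac{L_p^2\,\|x^0-x^*\|^2}{\varepsilon^2}\right)$$ computations of the operator $P$.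
   Context: $\langle\cdot,\cdot\rangle$ and $\|\cdot\|$ are the standard Euclidean inner product and norm on $\mathbb{R}^d$. $Q$ is $L_q$-Lipschitz if $\|Q(x_1)-Q(x_2)\|\le L_q\|x_1-x_2\|$ for all $x_1,x_2\in\mathbb{R}^d$ (similarly for $P$ with $L_p$), and monotone if $\langle Q(x_1)-Q(x_2),x_1-x_2\rangle\ge 0$ for all $x_1,x_2\in\mathbb{R}^d$. $P$ is not assumed monotone. The problem being solved is the composite variational inequality: find $x^*\in\mathbb{R}^d$ with $R(x^* )=0$. Extragradient Sliding algorithm: given a starting point $x^0\in\mathbb{R}^d$, stepsizes $\eta,\theta>0$ and a number of iterations $K\in\mathbb{N}$, for $k=0,1,\dots,K-1$: define $B_\theta^k(x):=P(x^k)+Q(x)+\frac1\theta(x-x^k)$; let $\tilde u^k\in\mathbb{R}^d$ be the solution of $B_\theta^k(\tilde u^k)=0$; find $u^k\approx\tilde u^k$; set $x^{k+1}=x^k-\eta R(u^k)$. Each iteration calls $P$ twice: once for $P(x^k)$, which stays fixed in the inner subproblem, and once for $P(u^k)$ in computing $R(u^k)$. *)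

theory Defs
  imports Complex_Main "HOL-Library.FuncSet" "Jordan_Normal_Form.Matrix"
begin

(* The space \<real>\<^sup>d is carrier_vec d :: real vec set, so that d is an ordinary natural number and
   an absolute constant (independent of d) can be quantified in front of it. *)

definition vnorm :: "real vec \<Rightarrow> real" where
  "vnorm v = sqrt (v \<bullet> v)"

definition lipschitz_vec :: "nat \<Rightarrow> real \<Rightarrow> (real vec \<Rightarrow> real vec) \<Rightarrow> bool" where
  "lipschitz_vec d L F \<longleftrightarrow>
     (\<forall>x1\<in>carrier_vec d. \<forall>x2\<in>carrier_vec d. vnorm (F x1 - F x2) \<le> L * vnorm (x1 - x2))"

definition monotone_vec :: "nat \<Rightarrow> (real vec \<Rightarrow> real vec) \<Rightarrow> bool" where
  "monotone_vec d F \<longleftrightarrow>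
     (\<forall>x1\<in>carrier_vec d. \<forall>x2\<in>carrier_vec d. (F x1 - F x2) \<bullet> (x1 - x2) \<ge> 0)"

definition op_sum ::
  "(real vec \<Rightarrow> real vec) \<Rightarrow> (real vec \<Rightarrow> real vec) \<Rightarrow> real vec \<Rightarrow> real vec" where
  "op_sum P Q x = P x + Q x"

definition minty_solution :: "nat \<Rightarrow> (real vec \<Rightarrow> real vec) \<Rightarrow> real vec \<Rightarrow> bool" where
  "minty_solution d R xs \<longleftrightarrow>
     xs \<in> carrier_vec d \<and> (\<forall>x\<in>carrier_vec d. R x \<bullet> (x - xs) \<ge> 0)"

definition inner_op ::
  "(real vec \<Rightarrow> real vec) \<Rightarrow> (real vec \<Rightarrow> real vec) \<Rightarrow> real \<Rightarrow> real vec \<Rightarrow> real vec \<Rightarrow> real vec" where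
  "inner_op P Q \<theta> xk x = P xk + Q x + (1 / \<theta>) \<cdot>\<^sub>v (x - xk)"

(* x, u, ut are the iterates, the approximate and the exact inner solutions of a run with K
   iterations. Only x 0, ..., x K and u k, ut k for k < K are constrained. How well u k
   approximates ut k is a separate condition. *)
definition extragradient_sliding ::
  "nat \<Rightarrow> (real vec \<Rightarrow> real vec) \<Rightarrow> (real vec \<Rightarrow> real vec) \<Rightarrow> real \<Rightarrow> real \<Rightarrow> real vec \<Rightarrow> nat
    \<Rightarrow> (nat \<Rightarrow> real vec) \<Rightarrow> (nat \<Rightarrow> real vec) \<Rightarrow> (nat \<Rightarrow> real vec) \<Rightarrow> bool" where
  "extragradient_sliding d P Q \<theta> \<eta> x0 K x u ut \<longleftrightarrow>
     x 0 = x0 \<and>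
     (\<forall>k<K. ut k \<in> carrier_vec d \<and> inner_op P Q \<theta> (x k) (ut k) = 0\<^sub>v d \<and>
            u k \<in> carrier_vec d \<and>
            x (Suc k) = x k - \<eta> \<cdot>\<^sub>v op_sum P Q (u k))"

(* The points at which P is evaluated, in order: iteration k computes P (x k), which stays fixed
   in the inner subproblem, and P (u k). The length of the list is the number of computations
   of P. *)
definition P_queries :: "(nat \<Rightarrow> real vec) \<Rightarrow> (nat \<Rightarrow> real vec) \<Rightarrow> nat \<Rightarrow> real vec list" where
  "P_queries x u K = concat (map (\<lambda>k. [x k, u k]) [0..<K])"

end

theory Submission
  imports Defs
begin

text \<open>
  With \<open>\<theta> = 1/(2 L)\<close> the residual \<open>e = R u - (x - u)/\<theta>\<close> equals \<open>B u + (P u - P x)\<close>.  Polarising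
  \<open>2\<langle>R u, x - u\<rangle> = \<theta> (\<parallel>R u\<parallel>\<^sup>2 + \<parallel>x - u\<parallel>\<^sup>2/\<theta>\<^sup>2 - \<parallel>e\<parallel>\<^sup>2)\<close> and using the Minty condition, one step decreases
  \<open>\<parallel>x - x*\<parallel>\<^sup>2\<close> by at least \<open>\<theta>\<^sup>2 \<parallel>R u\<parallel>\<^sup>2/4\<close>, provided \<open>\<theta>\<^sup>2 \<parallel>B u\<parallel>\<^sup>2 \<le> \<parallel>x - u\<parallel>\<^sup>2/4\<close>.  The latter follows from the
  accuracy criterion, because \<open>B\<close> is \<open>1/\<theta>\<close>-strongly monotone, so that \<open>u\<close> is close to the exact
  solution.  Summing the decrease over the iterations gives the rate.
\<close>

lemma vnorm_square: "(vnorm v)\<^sup>2 = (\<Sum>i<dim_vec v. (v $ i)\<^sup>2)"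
  by (simp add: vnorm_def scalar_prod_def sum_nonneg atLeast0LessThan power2_eq_square)

lemma vnorm_nonneg: "0 \<le> vnorm v"
  by (simp add: vnorm_def scalar_prod_def sum_nonneg)

text \<open>Written in coordinates, so that each estimate becomes a termwise identity with a square
  as remainder. Here \<open>w\<close> is the exact inner solution and \<open>z\<close> the Minty
  point.\<close>

lemma extragradient_sliding_step_sum:
  fixes x u w z px pu qu qw :: "'i \<Rightarrow> real" and L :: real
  assumes L: "L > 0"
    and minty: "(\<Sum>i\<in>I. (pu i + qu i) * (u i - z i)) \<ge> 0"
    and mono: "(\<Sum>i\<in>I. (qu i - qw i) * (u i - w i)) \<ge> 0"
    and lip: "(\<Sum>i\<in>I. (pu i - px i)\<^sup>2) \<le> L\<^sup>2 * (\<Sum>i\<in>I. (u i - x i)\<^sup>2)"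
    and exact: "\<And>i. i \<in> I \<Longrightarrow> px i + qw i + 2 * L * (w i - x i) = 0"
    and approx: "(\<Sum>i\<in>I. (px i + qu i + 2 * L * (u i - x i))\<^sup>2)
                   \<le> L\<^sup>2 / 3 * (\<Sum>i\<in>I. (x i - w i)\<^sup>2)"
  shows "(\<Sum>i\<in>I. (x i - (pu i + qu i) / (4 * L) - z i)\<^sup>2)
           + (\<Sum>i\<in>I. (pu i + qu i)\<^sup>2) / (16 * L\<^sup>2) \<le> (\<Sum>i\<in>I. (x i - z i)\<^sup>2)"
proof -
  define b where "b i = px i + qu i + 2 * L * (u i - x i)" for i
  define B where "B = (\<Sum>i\<in>I. (b i)\<^sup>2)"
  define U where "U = (\<Sum>i\<in>I. (u i - x i)\<^sup>2)"
  define W where "W = (\<Sum>i\<in>I. (u i - w i)\<^sup>2)"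
  define X where "X = (\<Sum>i\<in>I. (x i - w i)\<^sup>2)"
  have L2: "L\<^sup>2 > 0" using L by simp
  \<comment> \<open>Strong monotonicity of the inner operator in squared form. Monotonicity of
    \<open>Q\<close> gives the sign of the cross term only after summation, so it enters before the
    termwise comparison.\<close>
  have "4 * L\<^sup>2 * W \<le> 4 * L\<^sup>2 * W + 4 * L * (\<Sum>i\<in>I. (qu i - qw i) * (u i - w i))"
    using mono L by simp
  also have "\<dots> = (\<Sum>i\<in>I. 4 * L\<^sup>2 * (u i - w i)\<^sup>2 + 4 * L * ((qu i - qw i) * (u i - w i)))"
    by (simp add: W_def sum_distrib_left sum.distrib)
  also have "\<dots> \<le> B"
    unfolding B_def
  proof (rule sum_mono)
    fix i assume i: "i \<in> I"
    \<comment> \<open>The inner operator vanishes at \<open>w\<close>, so \<open>b\<close> is its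
      increment from \<open>w\<close> to \<open>u\<close>.\<close>
    have b: "b i = (qu i - qw i) + 2 * L * (u i - w i)"
      using exact[OF i] by (simp add: b_def algebra_simps)
    have "(b i)\<^sup>2 = (qu i - qw i)\<^sup>2 + (4 * L\<^sup>2 * (u i - w i)\<^sup>2 + 4 * L * ((qu i - qw i) * (u i - w i)))"
      unfolding b by (simp add: power2_eq_square algebra_simps)
    then show "4 * L\<^sup>2 * (u i - w i)\<^sup>2 + 4 * L * ((qu i - qw i) * (u i - w i)) \<le> (b i)\<^sup>2"
      by simp
  qed
  finally have WB: "4 * L\<^sup>2 * W \<le> B" .
  have "X \<le> (\<Sum>i\<in>I. 2 * (u i - x i)\<^sup>2 + 2 * (u i - w i)\<^sup>2)"
    unfolding X_def
  proof (rule sum_mono)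
    fix i
    have "2 * (u i - x i)\<^sup>2 + 2 * (u i - w i)\<^sup>2 = (x i - w i)\<^sup>2 + (2 * u i - x i - w i)\<^sup>2"
      by (simp add: power2_eq_square algebra_simps)
    then show "(x i - w i)\<^sup>2 \<le> 2 * (u i - x i)\<^sup>2 + 2 * (u i - w i)\<^sup>2"
      by simp
  qed
  also have "\<dots> = 2 * U + 2 * W"
    by (simp add: U_def W_def sum.distrib sum_distrib_left)
  finally have XUW: "X \<le> 2 * U + 2 * W" .
  have BX: "B \<le> L\<^sup>2 * X / 3"
    using approx by (simp add: B_def b_def X_def)
  \<comment> \<open>Since \<open>2 * L\<^sup>2 * W \<le> B / 2\<close>, this yields
    \<open>B \<le> (2 * L\<^sup>2 * U + B / 2) / 3\<close>. Absorbing \<open>B\<close> on the left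
    leaves the factor 4/5, which is rounded up to 1.\<close>
  have "L\<^sup>2 * X \<le> 2 * (L\<^sup>2 * U) + 2 * (L\<^sup>2 * W)"
    using mult_left_mono[OF XUW, of "L\<^sup>2"] L2 by (simp add: algebra_simps)
  moreover have "0 \<le> L\<^sup>2 * U"
    by (simp add: U_def sum_nonneg)
  ultimately have BU: "B \<le> L\<^sup>2 * U"
    using WB BX by simp
  have "(\<Sum>i\<in>I. (x i - (pu i + qu i) / (4 * L) - z i)\<^sup>2) + (\<Sum>i\<in>I. (pu i + qu i)\<^sup>2) / (16 * L\<^sup>2)
      = (\<Sum>i\<in>I. (x i - (pu i + qu i) / (4 * L) - z i)\<^sup>2 + (pu i + qu i)\<^sup>2 / (16 * L\<^sup>2))"
    by (simp add: sum.distrib sum_divide_distrib)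
  \<comment> \<open>Polarisation combined with
    \<open>(b + g)\<^sup>2 \<le> 2 * b\<^sup>2 + 2 * g\<^sup>2\<close>, where \<open>b + g\<close>
    is the residual. The gap between the two sides is exactly
    \<open>(b - g)\<^sup>2 / (8 * L\<^sup>2)\<close>.\<close>
  also have "\<dots> \<le> (\<Sum>i\<in>I. (x i - z i)\<^sup>2 - (pu i + qu i) * (u i - z i) / (2 * L)
      - (u i - x i)\<^sup>2 / 2 + (b i)\<^sup>2 / (4 * L\<^sup>2) + (pu i - px i)\<^sup>2 / (4 * L\<^sup>2))"
  proof (rule sum_mono)
    fix i
    define g where "g = pu i - px i"
    have r: "pu i + qu i = b i + g - 2 * L * (u i - x i)"
      by (simp add: b_def g_def)
    have "(x i - z i)\<^sup>2 - (pu i + qu i) * (u i - z i) / (2 * L)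
        - (u i - x i)\<^sup>2 / 2 + (b i)\<^sup>2 / (4 * L\<^sup>2) + g\<^sup>2 / (4 * L\<^sup>2)
      = (x i - (pu i + qu i) / (4 * L) - z i)\<^sup>2 + (pu i + qu i)\<^sup>2 / (16 * L\<^sup>2)
        + (b i - g)\<^sup>2 / (8 * L\<^sup>2)"
      unfolding r using L by (simp add: power2_eq_square field_simps)
    moreover have "0 \<le> (b i - g)\<^sup>2 / (8 * L\<^sup>2)"
      by simp
    ultimately show "(x i - (pu i + qu i) / (4 * L) - z i)\<^sup>2 + (pu i + qu i)\<^sup>2 / (16 * L\<^sup>2)
      \<le> (x i - z i)\<^sup>2 - (pu i + qu i) * (u i - z i) / (2 * L)
        - (u i - x i)\<^sup>2 / 2 + (b i)\<^sup>2 / (4 * L\<^sup>2) + (pu i - px i)\<^sup>2 / (4 * L\<^sup>2)"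
      unfolding g_def by linarith
  qed
  also have "\<dots> = (\<Sum>i\<in>I. (x i - z i)\<^sup>2) - (\<Sum>i\<in>I. (pu i + qu i) * (u i - z i)) / (2 * L)
      - U / 2 + B / (4 * L\<^sup>2) + (\<Sum>i\<in>I. (pu i - px i)\<^sup>2) / (4 * L\<^sup>2)"
    by (simp add: U_def B_def sum.distrib sum_subtractf sum_divide_distrib)
  also have "\<dots> \<le> (\<Sum>i\<in>I. (x i - z i)\<^sup>2)"
  proof -
    \<comment> \<open>The negative term \<open>- U / 2\<close> pays for both errors, a quarter of
      \<open>U\<close> each: the inexact inner solution and the change of \<open>P\<close> between
      \<open>x\<close> and \<open>u\<close>.\<close>
    have "B / (4 * L\<^sup>2) \<le> U / 4"
      using BU L2 by (simp add: field_simps)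
    moreover have "(\<Sum>i\<in>I. (pu i - px i)\<^sup>2) / (4 * L\<^sup>2) \<le> U / 4"
      using lip L2 by (simp add: U_def field_simps)
    moreover have "0 \<le> (\<Sum>i\<in>I. (pu i + qu i) * (u i - z i)) / (2 * L)"
      using minty L by simp
    ultimately show ?thesis by linarith
  qed
  finally show ?thesis .
qed

lemma extragradient_sliding_step:
  assumes P: "P \<in> carrier_vec d \<rightarrow> carrier_vec d" and Q: "Q \<in> carrier_vec d \<rightarrow> carrier_vec d"
    and minty: "minty_solution d (op_sum P Q) z"
    and mono: "monotone_vec d Q"
    and L: "L > 0" and lip: "lipschitz_vec d L P"
    and x: "x \<in> carrier_vec d" and u: "u \<in> carrier_vec d" and w: "w \<in> carrier_vec d"
    and exact: "inner_op P Q (1 / (2 * L)) x w = 0\<^sub>v d"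
    and approx: "(vnorm (inner_op P Q (1 / (2 * L)) x u))\<^sup>2 \<le> L\<^sup>2 / 3 * (vnorm (x - w))\<^sup>2"
  shows "(vnorm (x - (1 / (4 * L)) \<cdot>\<^sub>v op_sum P Q u - z))\<^sup>2 + (vnorm (op_sum P Q u))\<^sup>2 / (16 * L\<^sup>2)
           \<le> (vnorm (x - z))\<^sup>2"
proof -
  have z: "z \<in> carrier_vec d"
    using minty by (simp add: minty_solution_def)
  have [simp]: "P x \<in> carrier_vec d" "P u \<in> carrier_vec d"
    "Q u \<in> carrier_vec d" "Q w \<in> carrier_vec d"
    using P Q x u w by auto
  note [simp] = carrier_vecD[OF x] carrier_vecD[OF u] carrier_vecD[OF w] carrier_vecD[OF z]
    carrier_vecD[OF \<open>P x \<in> carrier_vec d\<close>] carrier_vecD[OF \<open>P u \<in> carrier_vec d\<close>]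
    carrier_vecD[OF \<open>Q u \<in> carrier_vec d\<close>] carrier_vecD[OF \<open>Q w \<in> carrier_vec d\<close>]
  have 1: "0 \<le> (\<Sum>i<d. (P u $ i + Q u $ i) * (u $ i - z $ i))"
  proof -
    have "0 \<le> op_sum P Q u \<bullet> (u - z)"
      using minty u by (simp add: minty_solution_def)
    then show ?thesis
      by (simp add: scalar_prod_def op_sum_def atLeast0LessThan)
  qed
  have 2: "0 \<le> (\<Sum>i<d. (Q u $ i - Q w $ i) * (u $ i - w $ i))"
  proof -
    have "0 \<le> (Q u - Q w) \<bullet> (u - w)"
      using mono u w by (simp add: monotone_vec_def)
    then show ?thesis
      by (simp add: scalar_prod_def atLeast0LessThan)
  qed
  have 3: "(\<Sum>i<d. (P u $ i - P x $ i)\<^sup>2) \<le> L\<^sup>2 * (\<Sum>i<d. (u $ i - x $ i)\<^sup>2)"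
  proof -
    have "vnorm (P u - P x) \<le> L * vnorm (u - x)"
      using lip u x by (simp add: lipschitz_vec_def)
    then have "(vnorm (P u - P x))\<^sup>2 \<le> (L * vnorm (u - x))\<^sup>2"
      by (rule power_mono) (rule vnorm_nonneg)
    then show ?thesis
      by (simp add: vnorm_square power_mult_distrib)
  qed
  have 4: "P x $ i + Q w $ i + 2 * L * (w $ i - x $ i) = 0" if "i \<in> {..<d}" for i
    using arg_cong[OF exact, of "\<lambda>v. v $ i"] that by (simp add: inner_op_def)
  have 5: "(\<Sum>i<d. (P x $ i + Q u $ i + 2 * L * (u $ i - x $ i))\<^sup>2)
             \<le> L\<^sup>2 / 3 * (\<Sum>i<d. (x $ i - w $ i)\<^sup>2)"
    using approx by (simp add: vnorm_square inner_op_def)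
  show ?thesis
    using extragradient_sliding_step_sum[OF L 1 2 3 4 5]
    by (simp add: vnorm_square op_sum_def)
qed

text \<open>The one-step decrease telescopes along the run.\<close>

lemma extragradient_sliding_energy:
  assumes P: "P \<in> carrier_vec d \<rightarrow> carrier_vec d" and Q: "Q \<in> carrier_vec d \<rightarrow> carrier_vec d"
    and minty: "minty_solution d (op_sum P Q) z"
    and mono: "monotone_vec d Q"
    and L: "L > 0" and lip: "lipschitz_vec d L P"
    and x0: "x0 \<in> carrier_vec d"
    and run: "extragradient_sliding d P Q (1 / (2 * L)) (1 / (4 * L)) x0 K x u ut"
    and approx: "\<And>k. k < K \<Longrightarrow> (vnorm (inner_op P Q (1 / (2 * L)) (x k) (u k)))\<^sup>2
                   \<le> L\<^sup>2 / 3 * (vnorm (x k - ut k))\<^sup>2"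
  shows "(\<Sum>k<K. (vnorm (op_sum P Q (u k)))\<^sup>2) \<le> 16 * L\<^sup>2 * (vnorm (x0 - z))\<^sup>2"
proof -
  note run' = run[unfolded extragradient_sliding_def]
  \<comment> \<open>The run constrains the iterates \<open>x k\<close> only through the start and
    the update, so their dimension has to be carried through the induction.\<close>
  have "x k \<in> carrier_vec d \<and>
      (vnorm (x k - z))\<^sup>2 + (\<Sum>j<k. (vnorm (op_sum P Q (u j)))\<^sup>2) / (16 * L\<^sup>2) \<le> (vnorm (x0 - z))\<^sup>2"
    if "k \<le> K" for k
    using that
  proof (induction k)
    case 0
    then show ?case using run' x0 by simp
  next
    case (Suc k)
    then have k: "k < K" and xk: "x k \<in> carrier_vec d" by simp_all
    have uk: "u k \<in> carrier_vec d" and utk: "ut k \<in> carrier_vec d"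
      and exact: "inner_op P Q (1 / (2 * L)) (x k) (ut k) = 0\<^sub>v d"
      and upd: "x (Suc k) = x k - (1 / (4 * L)) \<cdot>\<^sub>v op_sum P Q (u k)"
      using run' k by auto
    have "op_sum P Q (u k) \<in> carrier_vec d"
      using P Q uk unfolding op_sum_def by (intro add_carrier_vec) auto
    then have "x (Suc k) \<in> carrier_vec d"
      using xk by (simp add: upd)
    moreover have "(vnorm (x (Suc k) - z))\<^sup>2 + (vnorm (op_sum P Q (u k)))\<^sup>2 / (16 * L\<^sup>2)
        \<le> (vnorm (x k - z))\<^sup>2"
      unfolding upd
      by (rule extragradient_sliding_step[OF P Q minty mono L lip xk uk utk exact approx[OF k]])
    ultimately show ?case
      using Suc by (simp add: add_divide_distrib)
  qed
  from conjunct2[OF this[OF order_refl]]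
  have "(\<Sum>k<K. (vnorm (op_sum P Q (u k)))\<^sup>2) / (16 * L\<^sup>2) \<le> (vnorm (x0 - z))\<^sup>2"
    using zero_le_power2[of "vnorm (x K - z)"] by linarith
  then show ?thesis
    using L by (simp add: field_simps)
qed

lemma length_P_queries: "length (P_queries x u K) = 2 * K"
  by (induction K) (simp_all add: P_queries_def)

text \<open>The \<open>max 1\<close> accounts for small ratios: an index \<open>j < K\<close>
  already costs one iteration, hence two evaluations of \<open>P\<close>.\<close>

theorem corollary1:
  "\<exists>C::real. C > 0 \<and>
     (\<forall>(d::nat) (P::real vec \<Rightarrow> real vec) (Q::real vec \<Rightarrow> real vec) (Lp::real) (Lq::real)
        (xs::real vec) (x0::real vec) (\<theta>::real) (\<eta>::real) (\<epsilon>::real).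
        P \<in> carrier_vec d \<rightarrow> carrier_vec d \<longrightarrow>
        Q \<in> carrier_vec d \<rightarrow> carrier_vec d \<longrightarrow>
        minty_solution d (op_sum P Q) xs \<longrightarrow>
        lipschitz_vec d Lq Q \<longrightarrow> monotone_vec d Q \<longrightarrow>
        Lp > 0 \<longrightarrow> lipschitz_vec d Lp P \<longrightarrow>
        x0 \<in> carrier_vec d \<longrightarrow>
        \<theta> = 1 / (2 * Lp) \<longrightarrow> \<eta> = \<theta> / 2 \<longrightarrow>
        \<epsilon> > 0 \<longrightarrow>
        (\<exists>K::nat. \<forall>x u ut.
           extragradient_sliding d P Q \<theta> \<eta> x0 K x u ut \<longrightarrow>
           (\<forall>k<K. (vnorm (inner_op P Q \<theta> (x k) (u k)))\<^sup>2
                     \<le> Lp\<^sup>2 / 3 * (vnorm (x k - ut k))\<^sup>2) \<longrightarrow>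
           (\<exists>j<K. vnorm (op_sum P Q (u j)) \<le> \<epsilon>) \<and>
           real (length (P_queries x u K))
             \<le> C * max 1 (Lp\<^sup>2 * (vnorm (x0 - xs))\<^sup>2 / \<epsilon>\<^sup>2)))"
\<comment> \<open>With \<open>t\<close> the ratio in the bound, \<open>K \<le> 16 * t + 2\<close>
  iterations cost \<open>2 * K \<le> 32 * t + 4\<close> evaluations, at most 36 times
  \<open>max 1 t\<close>.\<close>
proof (rule exI[of _ 36], intro conjI allI impI, goal_cases)
  case 1
  show ?case by simp
next
  case (2 d P Q L Lq z x0 \<theta> \<eta> \<epsilon>)
  define t where "t = L\<^sup>2 * (vnorm (x0 - z))\<^sup>2 / \<epsilon>\<^sup>2"
  \<comment> \<open>The extra 1 makes \<open>16 * t < K\<close> strict even when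
    \<open>16 * t\<close> is an integer; in particular \<open>K = 1\<close> when
    \<open>t = 0\<close>.\<close>
  define K where "K = nat \<lceil>16 * t\<rceil> + 1"
  have "0 \<le> t" by (simp add: t_def)
  then have K: "16 * t < real K" "real K \<le> 16 * t + 2"
    unfolding K_def by linarith+
  have \<theta>: "\<theta> = 1 / (2 * L)" and \<eta>: "\<eta> = 1 / (4 * L)"
    using 2 by simp_all
  show ?case
    unfolding t_def[symmetric]
  proof (rule exI[of _ K], intro allI impI conjI, goal_cases)
    case (1 x u ut)
    have energy: "(\<Sum>k<K. (vnorm (op_sum P Q (u k)))\<^sup>2) \<le> 16 * L\<^sup>2 * (vnorm (x0 - z))\<^sup>2"
      using 1 2 by (intro extragradient_sliding_energy[of P d Q z L x0 K x u ut])
        (auto simp: \<theta> \<eta>)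
    show ?case
    proof (rule ccontr)
      \<comment> \<open>Otherwise all \<open>K\<close> summands exceed
        \<open>\<epsilon>\<^sup>2\<close>, and the energy bound forces
        \<open>K \<le> 16 * t\<close>.\<close>
      assume "\<not> (\<exists>j<K. vnorm (op_sum P Q (u j)) \<le> \<epsilon>)"
      then have "(\<Sum>k<K. \<epsilon>\<^sup>2) \<le> (\<Sum>k<K. (vnorm (op_sum P Q (u k)))\<^sup>2)"
        using \<open>\<epsilon> > 0\<close> by (intro sum_mono power_mono) (auto simp: not_le intro: less_imp_le)
      with energy have "real K * \<epsilon>\<^sup>2 \<le> 16 * L\<^sup>2 * (vnorm (x0 - z))\<^sup>2"
        by simp
      then have "real K \<le> 16 * t"
        using \<open>\<epsilon> > 0\<close> by (simp add: t_def field_simps)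
      with K(1) show False by simp
    qed
  next
    case (2 x u ut)
    show ?case
      using K(2) by (simp add: length_P_queries max_def)
  qed
qed

end
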